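(* Assume $0\in I\subseteq\mathbb{R}_+$ or $I=\mathbb{R}$. A function $f\colon I^n\to\mathbb{R}$ is horizontally min-additive if and only if there exists $g\colon I^n\to\mathbb{R}$, with $\delta_g$ additive and $\delta_g^A|_{I_+}$ additive for every $A\subseteq[n]$, such that, for every $\sigma\in S_n$, $$f(\mathbf{x})=\delta_g(x_{\sigma(1)})+\sum_{i=2}^n\delta_g^{A_\sigma^{\uparrow}(i)}\big(x_{\sigma(i)}-x_{\sigma(i-1)}\big)\qquad(\mathbf{x}\in I^n_\sigma).$$ In this case, we can choose $g=f$.
   Context: $n\geq 1$ is an integer, $[n]=\{1,\ldots,n\}$, $S_n$ is the set of permutations of $[n]$, and $I$ is a nontrivial (i.e., of positive measure) real interval, possibly unbounded, containing $0$. $\mathbb{R}_+=[0,+\infty[$ and $I_+=I\cap\mathbb{R}_+$. For $\sigma\in S_n$, $I^n_\sigma=\{\mathbf{x}\in I^n : x_{\sigma(1)}\leq\cdots\leq x_{\sigma(n)}\}$ and $A_\sigma^{\uparrow}(i)=\{\sigma(i),\ldots,\sigma(n)\}$. For $A\subseteq[n]$, $\mathbf{1}_A$ is the $n$-tuple whose $i$th component is $1$ if $i\in A$ and $0$ otherwise. For $g\colon I^n\to\mathbb{R}$, $\delta_g^A\colon I\to\mathbb{R}$ is defined by $\delta_g^A(x)=g(x\mathbf{1}_A)$, and $\delta_g=\delta_g^{[n]}$. A function $u\colon K\to\mathbb{R}$ on an interval $K$ is additive if $u(x+x')=u(x)+u(x')$ whenever $x,x',x+x'\in K$. For $\mathbf{x}\in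 I^n$ and $c\in I$, $\mathbf{x}\wedge c$ is the $n$-tuple whose $i$th component is $\min(x_i,c)$, and $[\mathbf{x}]_c=\mathbf{x}-(\mathbf{x}\wedge c)$. A function $f\colon I^n\to\mathbb{R}$ is horizontally min-additive if $f(\mathbf{x})=f(\mathbf{x}\wedge c)+f([\mathbf{x}]_c)$ for every $\mathbf{x}\in I^n$ and every $c\in I$ such that $[\mathbf{x}]_c\in I^n$. *)

theory Defs
  imports "HOL-Analysis.Analysis" "HOL-Combinatorics.Permutations"
begin

text \<open>
  An \<open>n\<close>-tuple with entries in \<open>I\<close> is an element of \<open>{1..n} \<rightarrow>\<^sub>E I\<close>: a function on \<open>nat\<close> with
  values in \<open>I\<close> on \<open>{1..n}\<close> and \<open>undefined\<close> elsewhere, so that equal tuples are equal functions.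
  A real function \<open>f\<close> on \<open>I\<^sup>n\<close> is represented by a total function; its values outside
  \<open>{1..n} \<rightarrow>\<^sub>E I\<close> are irrelevant.
\<close>

definition cube :: "nat \<Rightarrow> real set \<Rightarrow> (nat \<Rightarrow> real) set" where
  "cube n I = ({1..n} \<rightarrow>\<^sub>E I)"

definition sorted_cube :: "nat \<Rightarrow> real set \<Rightarrow> (nat \<Rightarrow> nat) \<Rightarrow> (nat \<Rightarrow> real) set" where
  "sorted_cube n I \<sigma> = {x \<in> cube n I. \<forall>i\<in>{1..<n}. x (\<sigma> i) \<le> x (\<sigma> (i + 1))}"

definition up_set :: "nat \<Rightarrow> (nat \<Rightarrow> nat) \<Rightarrow> nat \<Rightarrow> nat set" where
  "up_set n \<sigma> i = \<sigma> ` {i..n}"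

definition delta :: "nat \<Rightarrow> ((nat \<Rightarrow> real) \<Rightarrow> real) \<Rightarrow> nat set \<Rightarrow> real \<Rightarrow> real" where
  "delta n g A x = g (\<lambda>i\<in>{1..n}. x * indicator A i)"

definition additive_on :: "real set \<Rightarrow> (real \<Rightarrow> real) \<Rightarrow> bool" where
  "additive_on K u \<longleftrightarrow> (\<forall>x\<in>K. \<forall>x'\<in>K. x + x' \<in> K \<longrightarrow> u (x + x') = u x + u x')"

definition tuple_min :: "nat \<Rightarrow> (nat \<Rightarrow> real) \<Rightarrow> real \<Rightarrow> (nat \<Rightarrow> real)" where
  "tuple_min n x c = (\<lambda>i\<in>{1..n}. min (x i) c)"

definition tuple_excess :: "nat \<Rightarrow> (nat \<Rightarrow> real) \<Rightarrow> real \<Rightarrow> (nat \<Rightarrow> real)" where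
  "tuple_excess n x c = (\<lambda>i\<in>{1..n}. x i - tuple_min n x c i)"

definition horizontally_min_additive ::
    "nat \<Rightarrow> real set \<Rightarrow> ((nat \<Rightarrow> real) \<Rightarrow> real) \<Rightarrow> bool" where
  "horizontally_min_additive n I f \<longleftrightarrow>
     (\<forall>x\<in>cube n I. \<forall>c\<in>I. tuple_excess n x c \<in> cube n I \<longrightarrow>
        f x = f (tuple_min n x c) + f (tuple_excess n x c))"

definition min_additive_representation ::
    "nat \<Rightarrow> real set \<Rightarrow> ((nat \<Rightarrow> real) \<Rightarrow> real) \<Rightarrow> ((nat \<Rightarrow> real) \<Rightarrow> real) \<Rightarrow> bool" where
  "min_additive_representation n I f g \<longleftrightarrow>
     additive_on I (delta n g {1..n}) \<and>
     (\<forall>A\<subseteq>{1..n}. additive_on (I \<inter> {0..}) (delta n g A)) \<and>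
     (\<forall>\<sigma>. \<sigma> permutes {1..n} \<longrightarrow> (\<forall>x\<in>sorted_cube n I \<sigma>.
        f x = delta n g {1..n} (x (\<sigma> 1)) +
              (\<Sum>i = 2..n. delta n g (up_set n \<sigma> i) (x (\<sigma> i) - x (\<sigma> (i - 1))))))"

end

theory Submission imports Defs begin

text \<open>
  Sort the entries of \<open>x\<close> as \<open>y\<^sub>1 \<le> \<dots> \<le> y\<^sub>n\<close>, where \<open>y\<^sub>i = x (\<sigma> i)\<close>. Cutting \<open>x\<close> horizontally at
  the heights \<open>y\<^sub>i\<close> slices it into layers: the bottom layer is the constant tuple \<open>y\<^sub>1\<close>, and the
  layer between \<open>y\<^sub>k\<close> and \<open>y\<^bsub>k+1\<^esub>\<close> is \<open>y\<^bsub>k+1\<^esub> - y\<^sub>k\<close> times the indicator of the set of indices whose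
  entry lies above that layer (\<open>layer_excess\<close>). Horizontal min-additivity says exactly that \<open>f\<close>
  adds up over cuts, so by induction on the cut heights \<open>f\<close> is the sum of its values on the
  layers (\<open>layer_decomposition\<close>), which is the representation with \<open>g = f\<close>. Cutting a
  multiple of an indicator tuple gives the additivity of the functions \<open>\<delta>\<close>; for \<open>I = \<real>\<close> such a
  cut only handles sums with one nonnegative summand, and oddness, a consequence of that
  case, gives the rest (\<open>additive_on_UNIV_if_nonneg_summand\<close>).

  Conversely, \<open>y \<mapsto> min y c\<close> and \<open>y \<mapsto> y - min y c\<close> are both nondecreasing, so the permutation
  that sorts \<open>x\<close> also sorts its truncation and its excess. The representation may therefore be
  applied to all three tuples with the same index sets, and additivity of each \<open>\<delta>\<close> splits
  the formula for \<open>f x\<close> term by term.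

  The dichotomy for \<open>I\<close> makes every layer height a point of \<open>I\<close> (\<open>diff_mem\<close>). It also
  means that, when negative summands occur at all, every real number is a possible cut height,
  which the oddness argument relies on.
\<close>

section \<open>Intervals, cubes and sorting\<close>

lemma diff_mem:
  fixes I :: "real set"
  assumes "is_interval I" "0 \<in> I" "I \<subseteq> {0..} \<or> I = UNIV"
    and "u \<in> I" "v \<in> I" "u \<le> v"
  shows "v - u \<in> I"
proof (cases "I = UNIV")
  case False
  with assms have "0 \<le> v - u" "v - u \<le> v" by auto
  with assms show ?thesis by (meson mem_is_interval_1_I)
qed simp

lemma cube_mem: "x \<in> cube n I \<Longrightarrow> i \<in> {1..n} \<Longrightarrow> x i \<in> I"
  by (auto simp: cube_def)

lemma scaled_indicator_in_cube:
  assumes "0 \<in> I" "t \<in> I"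
  shows "(\<lambda>i\<in>{1..n}. t * indicator A i) \<in> cube n I"
  using assms by (auto simp: cube_def indicator_def)

lemma tuple_min_in_cube:
  assumes "x \<in> cube n I" "c \<in> I"
  shows "tuple_min n x c \<in> cube n I"
  using assms by (auto simp: cube_def tuple_min_def min_def)

lemma sorted_cube_mono:
  assumes "x \<in> sorted_cube n I \<sigma>" "1 \<le> i" "i \<le> j" "j \<le> n"
  shows "x (\<sigma> i) \<le> x (\<sigma> j)"
  using assms(3,4)
proof (induction rule: dec_induct)
  case (step m)
  then have "x (\<sigma> m) \<le> x (\<sigma> (m + 1))"
    using assms(1,2) by (auto simp: sorted_cube_def)
  with step show ?case by simp
qed simp

lemma sorting_permutation:
  fixes x :: "nat \<Rightarrow> real"
  obtains \<sigma> where "\<sigma> permutes {1..n}" "\<forall>i\<in>{1..<n}. x (\<sigma> i) \<le> x (\<sigma> (i + 1))"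
proof -
  define xs where "xs = sort_key x [1..<Suc n]"
  have len: "length xs = n" and set_xs: "set xs = {1..n}" and dist: "distinct xs"
    by (auto simp: xs_def)
  have sorted: "sorted (map x xs)" by (simp add: xs_def)
  define \<sigma> where "\<sigma> = (\<lambda>i. if i \<in> {1..n} then xs ! (i - 1) else i)"
  have "bij_betw (\<lambda>i. i - 1) {1..n} {..<n}"
    by (rule bij_betw_byWitness[where f' = Suc]) auto
  moreover have "bij_betw ((!) xs) {..<n} {1..n}"
    using bij_betw_nth[OF dist] len set_xs by simp
  ultimately have "bij_betw ((!) xs \<circ> (\<lambda>i. i - 1)) {1..n} {1..n}"
    by (rule bij_betw_trans)
  then have "bij_betw \<sigma> {1..n} {1..n}"
    by (rule bij_betw_cong[THEN iffD1, rotated]) (auto simp: \<sigma>_def)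
  then have "\<sigma> permutes {1..n}"
    by (rule bij_imp_permutes) (auto simp: \<sigma>_def)
  moreover have "x (\<sigma> i) \<le> x (\<sigma> (i + 1))" if "i \<in> {1..<n}" for i
  proof -
    have "map x xs ! (i - 1) \<le> map x xs ! i"
      using that len by (intro sorted_nth_mono[OF sorted]) auto
    with that len show ?thesis by (auto simp: \<sigma>_def)
  qed
  ultimately show thesis using that by blast
qed

section \<open>From min-additivity to the representation\<close>

lemma min_additive_cut:
  assumes "horizontally_min_additive n I f" "x \<in> cube n I" "c \<in> I"
    and "tuple_excess n x c \<in> cube n I"
  shows "f x = f (tuple_min n x c) + f (tuple_excess n x c)"
  using assms by (auto simp: horizontally_min_additive_def)

text \<open>
  The tuple \<open>(s + t) 1\<^sub>A\<close>, cut at height \<open>t\<close>, leaves \<open>t 1\<^sub>A\<close> below and \<open>s 1\<^sub>A\<close> above, provided that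
  \<open>s\<close> is nonnegative. The zero entries outside \<open>A\<close> are unaffected by the cut only if \<open>t\<close> is
  nonnegative too, or if there are none.
\<close>

lemma delta_add:
  assumes f: "horizontally_min_additive n I f" and "0 \<in> I"
    and I: "s \<in> I" "t \<in> I" "s + t \<in> I"
    and "0 \<le> s" and "0 \<le> t \<or> A = {1..n}"
  shows "delta n f A (s + t) = delta n f A s + delta n f A t"
proof -
  define x where "x = (\<lambda>i\<in>{1..n}. (s + t) * indicator A i)"
  have "x \<in> cube n I"
    unfolding x_def using assms by (intro scaled_indicator_in_cube)
  moreover have low: "tuple_min n x t = (\<lambda>i\<in>{1..n}. t * indicator A i)"
    using assms(6,7) by (auto simp: tuple_min_def x_def indicator_def fun_eq_iff)
  have high: "tuple_excess n x t = (\<lambda>i\<in>{1..n}. s * indicator A i)"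
    using assms(6,7) by (auto simp: tuple_excess_def tuple_min_def x_def indicator_def fun_eq_iff)
  moreover have "tuple_excess n x t \<in> cube n I"
    unfolding high using assms by (intro scaled_indicator_in_cube)
  ultimately have "f x = f (tuple_min n x t) + f (tuple_excess n x t)"
    using f I by (intro min_additive_cut)
  then show ?thesis unfolding low high by (simp only: delta_def x_def add.commute)
qed

text \<open>
  If \<open>s\<close> is negative, moving \<open>u s\<close> to the other side as \<open>u (- s)\<close> brings the sum back to
  the case of a nonnegative summand.
\<close>

lemma additive_on_UNIV_if_nonneg_summand:
  fixes u :: "real \<Rightarrow> real"
  assumes add: "\<And>s t. 0 \<le> s \<Longrightarrow> u (s + t) = u s + u t"
  shows "additive_on UNIV u"
proof -
  have "u (s + t) = u s + u t" if "s < 0" for s t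
    using add[of 0 0] add[of "- s" s] add[of "- s" "s + t"] that by simp
  with add show ?thesis unfolding additive_on_def by (meson not_le)
qed

text \<open>
  No entry lies strictly between two consecutive sorted entries \<open>y\<^sub>k\<close> and \<open>y\<^bsub>k+1\<^esub>\<close>, so each
  coordinate of \<open>x\<close> crosses the whole layer between these heights or does not enter it.
  Deciding this by the position of the index under \<open>\<sigma>\<close>, rather than by comparing values,
  leaves ties without ambiguity: they only make the layer have height zero.
\<close>

lemma layer_excess:
  assumes \<sigma>: "\<sigma> permutes {1..n}" and x: "x \<in> sorted_cube n I \<sigma>" and k: "1 \<le> k" "k < n"
  shows "tuple_excess n (tuple_min n x (x (\<sigma> (Suc k)))) (x (\<sigma> k)) =
    (\<lambda>i\<in>{1..n}. (x (\<sigma> (Suc k)) - x (\<sigma> k)) * indicator (up_set n \<sigma> (Suc k)) i)"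
proof -
  note mono = sorted_cube_mono[OF x]
  have "min (x j) (x (\<sigma> (Suc k))) - min (min (x j) (x (\<sigma> (Suc k)))) (x (\<sigma> k)) =
      (x (\<sigma> (Suc k)) - x (\<sigma> k)) * indicator (up_set n \<sigma> (Suc k)) j" if "j \<in> {1..n}" for j
  proof -
    obtain i where i: "i \<in> {1..n}" "j = \<sigma> i"
      using \<sigma> \<open>j \<in> {1..n}\<close> by (metis permutes_image imageE)
    have up: "j \<in> up_set n \<sigma> (Suc k) \<longleftrightarrow> Suc k \<le> i"
      using i permutes_inj[OF \<sigma>] by (auto simp: up_set_def inj_image_mem_iff)
    have step: "x (\<sigma> k) \<le> x (\<sigma> (Suc k))" using mono[of k "Suc k"] k by simp
    show ?thesis
    proof (cases "Suc k \<le> i")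
      case True
      with i have "x (\<sigma> (Suc k)) \<le> x j" using mono[of "Suc k" i] by simp
      with True up step show ?thesis by simp
    next
      case False
      with i k have "x j \<le> x (\<sigma> k)" using mono[of i k] by simp
      with False up step show ?thesis by simp
    qed
  qed
  then show ?thesis
    by (auto simp: tuple_excess_def tuple_min_def fun_eq_iff)
qed

text \<open>
  Truncating \<open>x\<close> at its \<open>k\<close>-th smallest entry keeps exactly the layers up to \<open>k\<close>; raising the
  truncation height from one entry to the next adds one layer, and a cut separates it off.
\<close>

lemma layer_decomposition:
  assumes f: "horizontally_min_additive n I f"
    and I: "is_interval I" "0 \<in> I" "I \<subseteq> {0..} \<or> I = UNIV"
    and \<sigma>: "\<sigma> permutes {1..n}" and x: "x \<in> sorted_cube n I \<sigma>"
    and k: "1 \<le> k" "k \<le> n"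
  shows "f (tuple_min n x (x (\<sigma> k))) = delta n f {1..n} (x (\<sigma> 1)) +
    (\<Sum>i = 2..k. delta n f (up_set n \<sigma> i) (x (\<sigma> i) - x (\<sigma> (i - 1))))"
  using k
proof (induction k rule: dec_induct)
  case base
  have "x (\<sigma> 1) \<le> x j" if j: "j \<in> {1..n}" for j
  proof -
    obtain i where "i \<in> {1..n}" "j = \<sigma> i"
      using \<sigma> j by (metis permutes_image imageE)
    then show ?thesis using sorted_cube_mono[OF x, of 1 i] by simp
  qed
  then have "tuple_min n x (x (\<sigma> 1)) = (\<lambda>i\<in>{1..n}. x (\<sigma> 1) * indicator {1..n} i)"
    by (auto simp: tuple_min_def fun_eq_iff)
  then have "f (tuple_min n x (x (\<sigma> 1))) = delta n f {1..n} (x (\<sigma> 1))"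
    by (simp only: delta_def)
  then show ?case by simp
next
  case (step k)
  have cube: "x \<in> cube n I" using x by (simp add: sorted_cube_def)
  have entry: "x (\<sigma> i) \<in> I" if "i \<in> {1..n}" for i
    using cube_mem[OF cube] permutes_in_image[OF \<sigma>] that by blast
  let ?a = "x (\<sigma> k)" and ?b = "x (\<sigma> (Suc k))"
  let ?z = "tuple_min n x ?b"
  have le: "?a \<le> ?b" using sorted_cube_mono[OF x, of k "Suc k"] step by simp
  have ab: "?a \<in> I" "?b \<in> I" using entry step by auto
  have excess: "tuple_excess n ?z ?a =
      (\<lambda>i\<in>{1..n}. (?b - ?a) * indicator (up_set n \<sigma> (Suc k)) i)"
    using layer_excess[OF \<sigma> x] step by simp
  have "f ?z = f (tuple_min n ?z ?a) + f (tuple_excess n ?z ?a)"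
  proof (rule min_additive_cut[OF f _ ab(1)])
    show "?z \<in> cube n I" using tuple_min_in_cube[OF cube ab(2)] .
    show "tuple_excess n ?z ?a \<in> cube n I"
      unfolding excess using diff_mem[OF I ab le] I(2) by (intro scaled_indicator_in_cube)
  qed
  also have "tuple_min n ?z ?a = tuple_min n x ?a"
    using le by (auto simp: tuple_min_def fun_eq_iff)
  also have "f (tuple_excess n ?z ?a) = delta n f (up_set n \<sigma> (Suc k)) (?b - ?a)"
    by (simp add: excess delta_def)
  finally show ?case using step by simp
qed

lemma min_additive_imp_representation:
  assumes n: "n \<ge> 1" and f: "horizontally_min_additive n I f"
    and I: "is_interval I" "0 \<in> I" "I \<subseteq> {0..} \<or> I = UNIV"
  shows "min_additive_representation n I f f"
  unfolding min_additive_representation_def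
proof (intro conjI allI impI ballI)
  show "additive_on (I \<inter> {0..}) (delta n f A)" for A
    using delta_add[OF f I(2)] by (auto simp: additive_on_def)
  show "additive_on I (delta n f {1..n})"
    using I(3)
  proof
    assume "I \<subseteq> {0..}"
    then show ?thesis
      using delta_add[OF f I(2)] by (auto simp: additive_on_def subset_iff)
  next
    assume "I = UNIV"
    then show ?thesis
      using delta_add[OF f I(2)] by (auto intro: additive_on_UNIV_if_nonneg_summand)
  qed
  fix \<sigma> x assume \<sigma>: "\<sigma> permutes {1..n}" and x: "x \<in> sorted_cube n I \<sigma>"
  have "x j \<le> x (\<sigma> n)" if j: "j \<in> {1..n}" for j
  proof -
    obtain i where "i \<in> {1..n}" "j = \<sigma> i"
      using \<sigma> j by (metis permutes_image imageE)
    then show ?thesis using sorted_cube_mono[OF x, of i n] by simp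
  qed
  then have "tuple_min n x (x (\<sigma> n)) = x"
    using x by (auto simp: tuple_min_def sorted_cube_def cube_def PiE_def extensional_def fun_eq_iff)
  then show "f x = delta n f {1..n} (x (\<sigma> 1)) +
      (\<Sum>i = 2..n. delta n f (up_set n \<sigma> i) (x (\<sigma> i) - x (\<sigma> (i - 1))))"
    using layer_decomposition[OF f I \<sigma> x n] by simp
qed

section \<open>From the representation to min-additivity\<close>

lemma representation_imp_min_additive:
  assumes n: "n \<ge> 1" and g: "min_additive_representation n I f g"
    and I: "is_interval I" "0 \<in> I" "I \<subseteq> {0..} \<or> I = UNIV"
  shows "horizontally_min_additive n I f"
  unfolding horizontally_min_additive_def
proof (intro ballI impI)
  fix x c assume x: "x \<in> cube n I" and c: "c \<in> I"
    and excess: "tuple_excess n x c \<in> cube n I"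
  let ?p = "tuple_min n x c" and ?q = "tuple_excess n x c"
  obtain \<sigma> where \<sigma>: "\<sigma> permutes {1..n}"
    and sorted: "\<forall>i\<in>{1..<n}. x (\<sigma> i) \<le> x (\<sigma> (i + 1))"
    using sorting_permutation by blast
  have p: "?p \<in> cube n I" using tuple_min_in_cube[OF x c] .
  have in_range: "\<sigma> i \<in> {1..n}" if "i \<in> {1..n}" for i
    using permutes_in_image[OF \<sigma>] that by blast
  have p_eq: "?p (\<sigma> i) = min (x (\<sigma> i)) c" and q_eq: "?q (\<sigma> i) = x (\<sigma> i) - min (x (\<sigma> i)) c"
    if "i \<in> {1..n}" for i
    using in_range[OF that] by (auto simp: tuple_min_def tuple_excess_def)
  have xs: "x \<in> sorted_cube n I \<sigma>" using x sorted by (simp add: sorted_cube_def)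
  have ps: "?p \<in> sorted_cube n I \<sigma>" and qs: "?q \<in> sorted_cube n I \<sigma>"
    using p excess sorted by (fastforce simp: sorted_cube_def p_eq q_eq min_def)+
  define D where "D = delta n g {1..n}"
  define E where "E = (\<lambda>i. delta n g (up_set n \<sigma> i))"
  have repr: "f z = D (z (\<sigma> 1)) + (\<Sum>i = 2..n. E i (z (\<sigma> i) - z (\<sigma> (i - 1))))"
    if "z \<in> sorted_cube n I \<sigma>" for z
    using g \<sigma> that by (auto simp: min_additive_representation_def D_def E_def)
  have D: "D (x (\<sigma> 1)) = D (?p (\<sigma> 1)) + D (?q (\<sigma> 1))"
  proof -
    have one: "1 \<in> {1..n}" using n by simp
    have "?p (\<sigma> 1) + ?q (\<sigma> 1) = x (\<sigma> 1)" using p_eq[OF one] q_eq[OF one] by simp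
    moreover have "additive_on I D" using g by (simp add: min_additive_representation_def D_def)
    ultimately show ?thesis
      using cube_mem[OF _ in_range[OF one]] x p excess unfolding additive_on_def by metis
  qed
  have E: "E i (x (\<sigma> i) - x (\<sigma> (i - 1))) =
      E i (?p (\<sigma> i) - ?p (\<sigma> (i - 1))) + E i (?q (\<sigma> i) - ?q (\<sigma> (i - 1)))"
    if i: "i \<in> {2..n}" for i
  proof -
    have i': "i \<in> {1..n}" "i - 1 \<in> {1..n}" using i by auto
    have mem: "z (\<sigma> i) - z (\<sigma> (i - 1)) \<in> I \<inter> {0..}" if z: "z \<in> sorted_cube n I \<sigma>" for z
    proof -
      have "z (\<sigma> (i - 1)) \<le> z (\<sigma> i)" using i by (intro sorted_cube_mono[OF z]) auto
      moreover have "z (\<sigma> i) \<in> I" "z (\<sigma> (i - 1)) \<in> I"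
        using z i' in_range cube_mem by (auto simp: sorted_cube_def)
      ultimately show ?thesis using diff_mem[OF I] by simp
    qed
    have "up_set n \<sigma> i \<subseteq> {1..n}"
      unfolding up_set_def using i by (intro image_subsetI in_range) auto
    then have "additive_on (I \<inter> {0..}) (E i)"
      using g by (simp add: min_additive_representation_def E_def)
    moreover have "(?p (\<sigma> i) - ?p (\<sigma> (i - 1))) + (?q (\<sigma> i) - ?q (\<sigma> (i - 1))) =
        x (\<sigma> i) - x (\<sigma> (i - 1))"
      unfolding p_eq[OF i'(1)] p_eq[OF i'(2)] q_eq[OF i'(1)] q_eq[OF i'(2)] by simp
    ultimately show ?thesis
      using mem[OF xs] mem[OF ps] mem[OF qs] unfolding additive_on_def by metis
  qed
  show "f x = f ?p + f ?q"
    unfolding repr[OF xs] repr[OF ps] repr[OF qs]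
    using D E by (simp add: sum.distrib)
qed

theorem theorem3:
  fixes n :: nat and I :: "real set" and f :: "(nat \<Rightarrow> real) \<Rightarrow> real"
  assumes "n \<ge> 1"
    and "is_interval I" and "emeasure lborel I > 0" and "0 \<in> I"
    and "I \<subseteq> {0..} \<or> I = UNIV"
  shows "(horizontally_min_additive n I f \<longleftrightarrow> (\<exists>g. min_additive_representation n I f g)) \<and>
         (horizontally_min_additive n I f \<longrightarrow> min_additive_representation n I f f)"
  using min_additive_imp_representation[OF assms(1) _ assms(2,4,5)]
    representation_imp_min_additive[OF assms(1) _ assms(2,4,5)]
  by blast

end
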